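(* Let $V$ be a simple vertex algebra of countable dimension and $G$ a finite automorphism group of $V$. Then $H\mapsto V^H$ gives a bijection between the subgroups of $G$ and the (vertex) subalgebras of $V$ containing $V^G$. In particular, any subalgebra of $V$ containing $V^G$ is simple.
   Context: All vector spaces are over $\mathbb{C}$; $\delta(z)=\sum_{n\in\mathbb{Z}}z^n$ and binomials are expanded in nonnegative powers of the second variable. A vertex algebra is a vector space $V$ with a vector $\mathbf{1}\in V$ and a linear map $v\mapsto Y(v,z)=\sum_{n\in\mathbb{Z}}v_nz^{-n-1}\in(\mathrm{End}\,V)[[z,z^{-1}]]$ such that $u_nv=0$ for $n$ large, $Y(\mathbf{1},z)=\mathrm{Id}_V$, $Y(v,z)\mathbf{1}\in V[[z]]$ with constant term $v$, and the Jacobi identity holds: $$z_0^{-1}\delta\left(\tfrac{z_1-z_2}{z_0}\right)Y(u,z_1)Y(v,z_2)-z_0^{-1}\delta\left(\tfrac{z_2-z_1}{-z_0}\right)Y(v,z_2)Y(u,z_1)=z_2^{-1}\delta\left(\tfrac{z_1-z_0}{z_2}\right)Y(Y(u,z_0)v,z_2).$$ A (vertex) subalgebra is a subspace $U$ containing $\mathbf{1}$ with $u_nv\in U$ for all $u,v\in U$, $n\in\mathbb{Z}$. A vertex algebra $V$ is simple if it is irreducible as a module over itself: it is nonzero and has no proper nonzero subspace stable under all operators $v_n$, $v\in V$, $n\in\mathbb{Z}$. An automorphism is an invertible linear map $g:V\to V$ with $g\mathbf{1}=\mathbf{1}$ and $gY(u,z)g^{-1}=Y(gu,z)$ for all $u\in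 V$; a finite automorphism group is a finite subgroup of the group of all automorphisms. For a group $H$ of automorphisms, $V^H=\{v\in V:hv=v\ \forall h\in H\}$. *)

theory Defs
  imports
    Complex_Main
    "HOL-Algebra.Group"
    "HOL-Library.Countable_Set"
    "HOL-Library.Groups_Big_Fun"
begin

text \<open>
  Coefficient of \<open>x^i y^j\<close> in \<open>(x - y)^n\<close> for an integer \<open>n\<close>, expanded in nonnegative powers
  of the second variable \<open>y\<close>.
\<close>
definition binomial_coeff :: "int \<Rightarrow> int \<Rightarrow> int \<Rightarrow> complex" where
  "binomial_coeff n i j =
     (if j \<ge> 0 \<and> i + j = n then (- 1) ^ nat j * (of_int n gchoose nat j) else 0)"

text \<open>
  Coefficient of \<open>x^i y^j z^l\<close> in
  \<open>z^(-1) \<delta>((x - y) / (\<epsilon> z)) = (\<Sum>n. \<epsilon>^(-n) z^(-n-1) (x - y)^n)\<close>, where \<open>\<epsilon>\<close> is \<open>1\<close> or \<open>-1\<close>;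
  only \<open>n = -l-1\<close> contributes.
\<close>
definition delta_coeff :: "complex \<Rightarrow> int \<Rightarrow> int \<Rightarrow> int \<Rightarrow> complex" where
  "delta_coeff \<epsilon> i j l = \<epsilon> powi (l + 1) * binomial_coeff (- l - 1) i j"

text \<open>
  The vector \<open>Y u n w\<close> is \<open>u_n w\<close>, so \<open>Y u n\<close> is the coefficient of \<open>z^(-n-1)\<close> in \<open>Y(u,z)\<close>.
  The Jacobi identity is stated by comparing, on each vector \<open>w\<close>, the coefficients of
  \<open>z\<^sub>0^a z\<^sub>1^b z\<^sub>2^c\<close>; the products of formal series are convolutions over the pairs of modes
  \<open>(p, q)\<close>. By truncation these sums have finitely many nonzero terms (see the lemmas
  \<open>finite_jacobi_left\<close> and \<open>finite_jacobi_right\<close>), so that \<^const>\<open>Sum_any\<close> is their actual value.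
\<close>
locale vertex_algebra = vector_space scale
  for scale :: "complex \<Rightarrow> 'v::ab_group_add \<Rightarrow> 'v" +
  fixes vac :: 'v
    and Y :: "'v \<Rightarrow> int \<Rightarrow> 'v \<Rightarrow> 'v"
  assumes linear_state: "Vector_Spaces.linear scale scale (\<lambda>u. Y u n w)"
    and linear_mode: "Vector_Spaces.linear scale scale (Y u n)"
    and truncation: "\<exists>N. \<forall>n\<ge>N. Y u n v = 0"
    and vacuum: "Y vac n = (if n = - 1 then id else (\<lambda>_. 0))"
    and creation_regular: "n \<ge> 0 \<Longrightarrow> Y v n vac = 0"
    and creation: "Y v (- 1) vac = v"
    and jacobi:
      "Sum_any (\<lambda>(p, q). scale (delta_coeff 1 (b + p + 1) (c + q + 1) a) (Y u p (Y v q w)))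
       - Sum_any (\<lambda>(p, q). scale (delta_coeff (- 1) (c + q + 1) (b + p + 1) a) (Y v q (Y u p w)))
       = Sum_any (\<lambda>(p, q). scale (delta_coeff 1 b (a + p + 1) (c + q + 1)) (Y (Y u p v) q w))"
begin

definition vertex_subalgebra :: "'v set \<Rightarrow> bool" where
  "vertex_subalgebra U \<longleftrightarrow>
     subspace U \<and> vac \<in> U \<and> (\<forall>u\<in>U. \<forall>v\<in>U. \<forall>n. Y u n v \<in> U)"

text \<open>
  Simplicity of a subalgebra \<open>U\<close>, regarded as a vertex algebra in its own right: only the modes
  of elements of \<open>U\<close> are required to preserve \<open>W\<close>. The whole algebra is the case \<open>U = UNIV\<close>.
\<close>
definition simple_vertex_algebra :: "'v set \<Rightarrow> bool" where
  "simple_vertex_algebra U \<longleftrightarrow>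
     U \<noteq> {0} \<and>
     (\<forall>W. subspace W \<and> W \<subseteq> U \<and> (\<forall>u\<in>U. \<forall>n. \<forall>w\<in>W. Y u n w \<in> W) \<longrightarrow> W = {0} \<or> W = U)"

definition countable_dimension :: bool where
  "countable_dimension \<longleftrightarrow> (\<exists>B. independent B \<and> span B = UNIV \<and> countable B)"

definition automorphism :: "('v \<Rightarrow> 'v) \<Rightarrow> bool" where
  "automorphism g \<longleftrightarrow>
     Vector_Spaces.linear scale scale g \<and> bij g \<and> g vac = vac \<and>
     (\<forall>u n. g \<circ> Y u n \<circ> inv_into UNIV g = Y (g u) n)"

definition Aut :: "('v \<Rightarrow> 'v) monoid" where
  "Aut = \<lparr>carrier = {g. automorphism g}, mult = (\<circ>), one = id\<rparr>"

definition fixed_points :: "('v \<Rightarrow> 'v) set \<Rightarrow> 'v set" where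
  "fixed_points H = {v. \<forall>h\<in>H. h v = v}"

lemma finite_jacobi_left:
  "finite {(p, q). scale (delta_coeff \<epsilon> (b + p + 1) (c + q + 1) a) (Y u p (Y v q w)) \<noteq> 0}"
proof -
  obtain N where N: "\<And>n. n \<ge> N \<Longrightarrow> Y v n w = 0"
    using truncation by blast
  have zero: "Y u p 0 = 0" for p
    using linear_mode[of u p] by (simp add: linear_iff_module_hom module_hom.zero)
  have "{(p, q). scale (delta_coeff \<epsilon> (b + p + 1) (c + q + 1) a) (Y u p (Y v q w)) \<noteq> 0}
      \<subseteq> (\<lambda>q. (- a - b - c - q - 3, q)) ` {- c - 1..N}"
  proof clarify
    fix p q
    assume nz: "scale (delta_coeff \<epsilon> (b + p + 1) (c + q + 1) a) (Y u p (Y v q w)) \<noteq> 0"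
    then have "q < N" using N zero by (metis not_le scale_zero_right)
    moreover from nz have "c + q + 1 \<ge> 0 \<and> b + p + 1 + (c + q + 1) = - a - 1"
      by (auto simp: delta_coeff_def binomial_coeff_def split: if_splits)
    ultimately show "(p, q) \<in> (\<lambda>q. (- a - b - c - q - 3, q)) ` {- c - 1..N}"
      by (intro image_eqI[of _ _ q]) auto
  qed
  then show ?thesis by (rule finite_subset) simp
qed

lemma finite_jacobi_right:
  "finite {(p, q). scale (delta_coeff \<epsilon> b (a + p + 1) (c + q + 1)) (Y (Y u p v) q w) \<noteq> 0}"
proof -
  obtain N where N: "\<And>n. n \<ge> N \<Longrightarrow> Y u n v = 0"
    using truncation by blast
  have zero: "Y 0 q w = 0" for q
    using module_hom.zero[OF linear_state[of q w, unfolded linear_iff_module_hom]] .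
  have "{(p, q). scale (delta_coeff \<epsilon> b (a + p + 1) (c + q + 1)) (Y (Y u p v) q w) \<noteq> 0}
      \<subseteq> (\<lambda>p. (p, - a - b - c - p - 3)) ` {- a - 1..N}"
  proof clarify
    fix p q
    assume nz: "scale (delta_coeff \<epsilon> b (a + p + 1) (c + q + 1)) (Y (Y u p v) q w) \<noteq> 0"
    then have "p < N" using N zero by (metis not_le scale_zero_right)
    moreover from nz have "a + p + 1 \<ge> 0 \<and> b + (a + p + 1) = - (c + q + 1) - 1"
      by (auto simp: delta_coeff_def binomial_coeff_def split: if_splits)
    ultimately show "(p, q) \<in> (\<lambda>p. (p, - a - b - c - p - 3)) ` {- a - 1..N}"
      by (intro image_eqI[of _ _ p]) auto
  qed
  then show ?thesis by (rule finite_subset) simp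
qed

lemma automorphism_comp:
  assumes "automorphism g" "automorphism h"
  shows "automorphism (g \<circ> h)"
proof -
  have "inv_into UNIV (g \<circ> h) = inv_into UNIV h \<circ> inv_into UNIV g"
    using assms by (intro o_inv_distrib) (auto simp: automorphism_def)
  then have "(g \<circ> h) \<circ> Y u n \<circ> inv_into UNIV (g \<circ> h)
      = g \<circ> (h \<circ> Y u n \<circ> inv_into UNIV h) \<circ> inv_into UNIV g" for u n
    by (simp add: comp_assoc)
  then have "(g \<circ> h) \<circ> Y u n \<circ> inv_into UNIV (g \<circ> h) = Y ((g \<circ> h) u) n" for u n
    using assms by (simp add: automorphism_def)
  with assms show ?thesis
    unfolding automorphism_def by (auto intro: bij_comp Vector_Spaces.linear_compose)
qed

lemma automorphism_inv:
  assumes "automorphism g"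
  shows "automorphism (inv_into UNIV g)"
proof -
  have bij: "bij g" and lin: "Vector_Spaces.linear scale scale g" and vac: "g vac = vac"
    and eq: "\<And>u n. g \<circ> Y u n \<circ> inv_into UNIV g = Y (g u) n"
    using assms by (auto simp: automorphism_def)
  have l [simp]: "inv_into UNIV g (g x) = x" and r [simp]: "g (inv_into UNIV g x) = x" for x
    using bij by (simp_all add: bij_is_inj bij_is_surj surj_f_inv_f)
  interpret g: Vector_Spaces.linear scale scale g by fact
  have "Vector_Spaces.linear scale scale (inv_into UNIV g)"
  proof (unfold_locales)
    show "inv_into UNIV g (x + y) = inv_into UNIV g x + inv_into UNIV g y" for x y
      by (metis g.add l r)
    show "inv_into UNIV g (scale c x) = scale c (inv_into UNIV g x)" for c x
      by (metis g.scale l r)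
  qed
  moreover have "inv_into UNIV g \<circ> Y u n \<circ> inv_into UNIV (inv_into UNIV g) = Y (inv_into UNIV g u) n" for u n
  proof
    fix w
    have "g (Y (inv_into UNIV g u) n (inv_into UNIV g (g w))) = Y (g (inv_into UNIV g u)) n (g w)"
      using fun_cong[OF eq[of "inv_into UNIV g u" n], of "g w"] by simp
    then have "inv_into UNIV g (Y u n (g w)) = Y (inv_into UNIV g u) n w" by (metis l r)
    then show "(inv_into UNIV g \<circ> Y u n \<circ> inv_into UNIV (inv_into UNIV g)) w = Y (inv_into UNIV g u) n w"
      using bij by (simp add: inv_inv_eq)
  qed
  moreover have "inv_into UNIV g vac = vac" using vac l by metis
  ultimately show ?thesis
    using bij by (simp add: automorphism_def bij_imp_bij_inv)
qed

lemma group_Aut: "group Aut"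
proof (rule groupI)
  show "\<one>\<^bsub>Aut\<^esub> \<in> carrier Aut"
    by (simp add: Aut_def automorphism_def linear_id)
  show "\<exists>y\<in>carrier Aut. y \<otimes>\<^bsub>Aut\<^esub> x = \<one>\<^bsub>Aut\<^esub>" if "x \<in> carrier Aut" for x
  proof (rule bexI)
    from that have x: "automorphism x" by (simp add: Aut_def)
    show "inv_into UNIV x \<in> carrier Aut"
      using automorphism_inv[OF x] by (simp add: Aut_def)
    show "inv_into UNIV x \<otimes>\<^bsub>Aut\<^esub> x = \<one>\<^bsub>Aut\<^esub>"
      using x by (simp add: Aut_def automorphism_def bij_is_inj)
  qed
qed (auto simp: Aut_def automorphism_comp)

end

end

theory Submission
  imports Defs "HOL-Computational_Algebra.Fundamental_Theorem_Algebra"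
    "HOL-Analysis.Continuum_Not_Denumerable"
begin

text \<open>
  Countable dimension gives Schur's lemma for the simple module \<open>V\<close>, hence Jacobson density: every
  linear map agrees on any finite set with a linear combination of modes (associativity replaces
  products of modes by such combinations). Averaging over \<open>G\<close>, every \<open>G\<close>-equivariant linear map
  agrees on finite sets with modes of \<open>V\<^sup>G\<close>. Density and locality show that
  \<open>u \<otimes> v \<mapsto> Y(u,z) v\<close> is injective on \<open>V \<otimes> V\<close>.

  Let \<open>U\<close> be a subalgebra. If \<open>\<Sum>\<^sub>g a(g) g\<close> kills \<open>U\<close>, apply it to \<open>Y(x,z) v\<close> with \<open>x, v \<in> U\<close>; by the
  injectivity \<open>\<Sum>\<^sub>g a(g) \<phi>(g v) g\<close> kills \<open>U\<close> for every functional \<open>\<phi>\<close>. As in Dedekind's independence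
  of characters, \<open>a\<close> then sums to zero over each class of elements of \<open>G\<close> with the same restriction
  to \<open>U\<close>. For \<open>U = V\<close> this is linear independence of automorphisms, which recovers \<open>H\<close> from \<open>V\<^sup>H\<close>. For
  \<open>V\<^sup>G \<subseteq> U\<close> with stabilizer \<open>H\<close> and a hypothetical \<open>v \<in> V\<^sup>H\<close> outside \<open>U\<close>, a functional \<open>\<psi>\<close> with
  \<open>\<psi>(U) = 0\<close> and \<open>\<psi>(v) = 1\<close> yields such a relation \<open>a(g) = \<psi>(g\<^sup>-\<^sup>1 v)\<close> whose sum over \<open>H\<close> is \<open>|H|\<close>.
\<close>

subsection \<open>Countable-dimensional complex vector spaces\<close>

text \<open>Extend a basis of \<open>U\<close> together with \<open>v\<close> to a basis of the
  whole space and take the coordinate at \<open>v\<close>.\<close>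

lemma (in vector_space) separating_functional:
  assumes U: "subspace U" and v: "v \<notin> U"
  obtains \<psi> where "Vector_Spaces.linear scale (*) \<psi>" "\<And>u. u \<in> U \<Longrightarrow> \<psi> u = 0" "\<psi> v = 1"
proof -
  obtain B where B: "B \<subseteq> U" "independent B" "U \<subseteq> span B"
    using maximal_independent_subset by blast
  have spanB: "span B = U"
    using B U by (simp add: span_minimal subset_antisym)
  then have ind: "independent (insert v B)"
    using B v by (simp add: independent_insert)
  define E where "E = extend_basis (insert v B)"
  have E: "independent E" "span E = UNIV" "insert v B \<subseteq> E"
    using ind extend_basis_superset[OF ind] by (simp_all add: E_def independent_extend_basis)
  define \<psi> where "\<psi> x = representation E x v" for x
  show thesis
  proof
    have "vector_space ((*) :: 'a \<Rightarrow> 'a \<Rightarrow> 'a)"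
      by unfold_locales (auto simp: algebra_simps)
    then show "Vector_Spaces.linear scale (*) \<psi>"
      using E vector_space_axioms
      by (simp add: Vector_Spaces.linear_iff \<psi>_def representation_add representation_scale)
    show "\<psi> u = 0" if "u \<in> U" for u
    proof -
      have "representation E u = representation B u"
        using E B that spanB by (intro representation_extend) auto
      moreover have "v \<notin> B" using v B by auto
      ultimately show ?thesis
        unfolding \<psi>_def using representation_ne_zero by metis
    qed
    show "\<psi> v = 1"
      using E by (simp add: \<psi>_def representation_basis)
  qed
qed

text \<open>Each vector lies in the span of a finite subset of \<open>B\<close>. There are countably
  many such subsets, and each span meets \<open>S\<close> in a finite set.\<close>

lemma (in vector_space) countable_independent:
  assumes B: "countable B" "span B = UNIV" and S: "independent S"
  shows "countable S"
proof -
  have sub: "S \<subseteq> (\<Union>T\<in>{T. T \<subseteq> B \<and> finite T}. S \<inter> span T)"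
  proof
    fix s assume "s \<in> S"
    have "s \<in> span B" using B by simp
    then obtain T r where T: "finite T" "T \<subseteq> B" and s: "s = (\<Sum>a\<in>T. scale (r a) a)"
      unfolding span_explicit by blast
    have "s \<in> span T"
      unfolding s by (intro span_sum span_scale span_base)
    then show "s \<in> (\<Union>T\<in>{T. T \<subseteq> B \<and> finite T}. S \<inter> span T)"
      using \<open>s \<in> S\<close> T by blast
  qed
  have "countable (S \<inter> span T)" if "finite T" for T
    using independent_span_bound[OF that, of "S \<inter> span T"] independent_mono[OF S]
    by (simp add: countable_finite)
  moreover have "countable {T. T \<subseteq> B \<and> finite T}"
    using countable_Collect_finite_subset[OF B(1)] by (simp add: conj_commute)
  ultimately have "countable (\<Union>T\<in>{T. T \<subseteq> B \<and> finite T}. S \<inter> span T)"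
    by (intro countable_UN) auto
  with sub show ?thesis
    by (rule countable_subset)
qed

section \<open>Polynomials in an endomorphism and its spectrum\<close>

locale complex_endomorphism = Vector_Spaces.linear scale scale d
  for scale :: "complex \<Rightarrow> 'v::ab_group_add \<Rightarrow> 'v" and d :: "'v \<Rightarrow> 'v"
begin

text \<open>The vector \<open>p(d) x\<close>, computed by Horner's rule.\<close>

definition poly_op :: "complex poly \<Rightarrow> 'v \<Rightarrow> 'v" where
  "poly_op p x = fold_coeffs (\<lambda>a y. scale a x + d y) p 0"

lemma poly_op_0 [simp]: "poly_op 0 x = 0"
  by (simp add: poly_op_def)

lemma poly_op_pCons [simp]: "poly_op (pCons a p) x = scale a x + d (poly_op p x)"
  by (cases "p = 0 \<and> a = 0") (auto simp: poly_op_def zero)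

lemma poly_op_add: "poly_op (p + q) x = poly_op p x + poly_op q x"
  by (induction p q rule: poly_induct2) (auto simp: add vs1.scale_left_distrib)

lemma poly_op_smult: "poly_op (smult c p) x = scale c (poly_op p x)"
  by (induction p) (auto simp: scale vs1.scale_right_distrib)

lemma poly_op_mult: "poly_op (p * q) x = poly_op p (poly_op q x)"
  by (induction p) (auto simp: poly_op_add poly_op_smult)

lemma poly_op_sum: "poly_op (\<Sum>i\<in>I. p i) x = (\<Sum>i\<in>I. poly_op (p i) x)"
  by (induction I rule: infinite_finite_induct) (auto simp: poly_op_add)

lemma poly_op_linear: "Vector_Spaces.linear scale scale (poly_op p)"
proof (induction p)
  case 0
  then show ?case by (simp add: Vector_Spaces.linear_iff vs1.vector_space_axioms)
next
  case (pCons a p)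
  then show ?case
    by (auto simp: Vector_Spaces.linear_iff vs1.scale_right_distrib add scale vs1.scale_left_commute)
qed

text \<open>Over the complex numbers \<open>p\<close> splits into linear factors, and each
  \<open>d - z\<close> is injective when \<open>d\<close> has no eigenvector.\<close>

lemma poly_op_eq_0:
  assumes inj: "\<And>\<alpha> x. d x = scale \<alpha> x \<Longrightarrow> x = 0"
    and "p \<noteq> 0" "poly_op p x = 0"
  shows "x = 0"
  using assms(2,3)
proof (induction "degree p" arbitrary: p x rule: less_induct)
  case less
  show ?case
  proof (cases "degree p = 0")
    case True
    then obtain a where "p = [:a:]" by (rule degree_eq_zeroE)
    then show ?thesis using less.prems by (auto simp: zero)
  next
    case False
    then have "\<not> constant (poly p)" by (simp add: constant_degree)
    then obtain z where "poly p z = 0"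
      using fundamental_theorem_of_algebra by blast
    then obtain q where q: "p = [:- z, 1:] * q"
      using poly_eq_0_iff_dvd[of p z] by (auto elim: dvdE)
    have "q \<noteq> 0" using less.prems q by auto
    then have "degree p = Suc (degree q)"
      unfolding q by (subst degree_mult_eq) auto
    moreover have "poly_op [:- z, 1:] (poly_op q x) = 0"
      using less.prems(2) unfolding q poly_op_mult .
    then have "d (poly_op q x) = scale z (poly_op q x)"
      by (simp add: zero)
    then have "poly_op q x = 0" by (rule inj)
    ultimately show ?thesis
      using less.hyps \<open>q \<noteq> 0\<close> by auto
  qed
qed

text \<open>If every \<open>d - \<alpha>\<close> were bijective, the vectors \<open>(d - \<alpha>)\<^sup>-\<^sup>1 v\<close> for \<open>\<alpha>\<close> in \<open>\<complex>\<close> would be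
  linearly independent (partial fractions), which is too many for a countable basis.\<close>

lemma exists_not_bij_shift:
  fixes v :: 'v
  assumes B: "countable B" "vs1.span B = UNIV" and v: "v \<noteq> 0"
  obtains \<alpha> where "\<not> bij (\<lambda>x. d x - scale \<alpha> x)"
proof -
  have False if bij: "\<And>\<alpha>. bij (\<lambda>x. d x - scale \<alpha> x)"
  proof -
    have inj: "x = 0" if "d x = scale \<alpha> x" for \<alpha> x
    proof -
      have "d x - scale \<alpha> x = d 0 - scale \<alpha> 0" by (simp add: that zero)
      then show ?thesis using injD[OF bij_is_inj[OF bij]] by blast
    qed
    define R where "R \<alpha> = inv_into UNIV (\<lambda>x. d x - scale \<alpha> x) v" for \<alpha>
    have R: "d (R \<alpha>) - scale \<alpha> (R \<alpha>) = v" for \<alpha>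
      unfolding R_def using surj_f_inv_f[OF bij_is_surj[OF bij]] .
    have R': "poly_op [:- \<alpha>, 1:] (R \<alpha>) = v" for \<alpha>
      using R[of \<alpha>] by (simp add: zero)
    have "inj R"
    proof (rule injI)
      fix \<alpha> \<mu> assume eq: "R \<alpha> = R \<mu>"
      have "scale (\<alpha> - \<mu>) (R \<mu>) = 0"
        using R[of \<alpha>] R[of \<mu>] unfolding eq by (simp add: vs1.scale_left_diff_distrib algebra_simps)
      moreover have "R \<mu> \<noteq> 0" using R[of \<mu>] v by (auto simp: zero)
      ultimately show "\<alpha> = \<mu>" by simp
    qed
    have "c \<mu> = 0"
      if S: "finite S" and sum: "(\<Sum>\<alpha>\<in>S. scale (c \<alpha>) (R \<alpha>)) = 0" and \<mu>: "\<mu> \<in> S" for S c \<mu>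
    proof -
      \<comment> \<open>Applying \<open>P(d)\<close> clears the denominators:
        \<open>R \<alpha>\<close> becomes \<open>Q \<alpha>\<close> evaluated at \<open>d\<close> on
        \<open>v\<close>, so the relation turns into \<open>q(d) v = 0\<close>.\<close>
      define P where "P = (\<Prod>\<alpha>\<in>S. [:- \<alpha>, 1:])"
      define Q where "Q \<alpha> = (\<Prod>\<nu>\<in>S - {\<alpha>}. [:- \<nu>, 1:])" for \<alpha> :: complex
      define q where "q = (\<Sum>\<alpha>\<in>S. smult (c \<alpha>) (Q \<alpha>))"
      interpret P: Vector_Spaces.linear scale scale "poly_op P" by (rule poly_op_linear)
      have PQ: "poly_op P (R \<alpha>) = poly_op (Q \<alpha>) v" if "\<alpha> \<in> S" for \<alpha>
      proof -
        have "P = Q \<alpha> * [:- \<alpha>, 1:]"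
          unfolding P_def Q_def using S that by (subst prod.remove[of S \<alpha>]) (auto simp: mult.commute)
        then show ?thesis using R'[of \<alpha>] by (simp only: poly_op_mult)
      qed
      have "poly_op q v = poly_op P (\<Sum>\<alpha>\<in>S. scale (c \<alpha>) (R \<alpha>))"
        by (simp add: q_def poly_op_sum poly_op_smult P.sum P.scale PQ)
      also have "\<dots> = 0" using sum P.zero by simp
      finally have "poly_op q v = 0" .
      then have "q = 0"
        using v inj poly_op_eq_0[of q v] by metis
      \<comment> \<open>Lagrange interpolation: at \<open>\<mu>\<close> only the summand of
        \<open>\<mu>\<close> survives in \<open>q\<close>, which isolates its coefficient.\<close>
      have "poly (Q \<alpha>) \<mu> = 0" if "\<alpha> \<in> S" "\<alpha> \<noteq> \<mu>" for \<alpha>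
        using S that \<mu> by (auto simp: Q_def poly_prod intro!: prod_zero bexI[of _ \<mu>])
      then have "poly q \<mu> = c \<mu> * poly (Q \<mu>) \<mu>"
        unfolding q_def poly_sum using S \<mu> by (subst sum.remove[of S \<mu>]) (auto intro!: sum.neutral)
      moreover have "poly (Q \<mu>) \<mu> \<noteq> 0"
        using S by (auto simp: Q_def poly_prod)
      ultimately show ?thesis using \<open>q = 0\<close> by simp
    qed
    note indep = this
    have "vs1.independent (range R)"
      unfolding vs1.independent_explicit_finite_subsets
    proof (intro allI impI ballI)
      fix S u x
      assume S: "S \<subseteq> range R" "finite S" and sum: "(\<Sum>x\<in>S. scale (u x) x) = 0" and x: "x \<in> S"
      define L where "L = R -` S"
      have L: "R ` L = S" "finite L"
        using S \<open>inj R\<close> by (auto simp: L_def finite_vimageI)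
      have "(\<Sum>\<alpha>\<in>L. scale (u (R \<alpha>)) (R \<alpha>)) = 0"
        using sum L(1) \<open>inj R\<close> sum.reindex[of R L "\<lambda>x. scale (u x) x"] by (simp add: inj_on_subset)
      then show "u x = 0" using indep[OF L(2)] x L by auto
    qed
    then have "countable (range R)"
      using B vs1.countable_independent by blast
    then have "countable (UNIV :: complex set)"
      using \<open>inj R\<close> countable_image_inj_on by blast
    then have "countable (range complex_of_real)"
      by (rule countable_subset[rotated]) simp
    then have "countable (UNIV :: real set)"
      by (rule countable_image_inj_on) (simp add: inj_of_real)
    then show False using uncountable_UNIV_real by simp
  qed
  then show thesis using that by blast
qed

end

subsection \<open>Relations between modes\<close>

context vertex_algebra
begin

lemmas mode_hom = linear_mode[unfolded linear_iff_module_hom]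
lemmas state_hom = linear_state[unfolded linear_iff_module_hom]

lemmas mode_zero [simp] = module_hom.zero[OF mode_hom]
  and mode_add = module_hom.add[OF mode_hom]
  and mode_diff = module_hom.diff[OF mode_hom]
  and mode_scale = module_hom.scale[OF mode_hom]
  and mode_sum = module_hom.sum[OF mode_hom]
  and state_zero [simp] = module_hom.zero[OF state_hom]
  and state_add = module_hom.add[OF state_hom]
  and state_scale = module_hom.scale[OF state_hom]
  and state_sum = module_hom.sum[OF state_hom]

lemma mode_vac: "Y vac (- 1) w = w"
  by (simp add: vacuum)

text \<open>One cut-off for finitely many pairs, in the form of the hypotheses of
  \<open>borcherds\<close>.\<close>

lemma truncation_uniform:
  assumes "finite I"
  obtains J :: nat where "\<And>i n. i \<in> I \<Longrightarrow> n \<ge> k + int J \<Longrightarrow> Y (u i) n (v i) = 0"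
proof -
  have "\<exists>J::nat. \<forall>i\<in>I. \<forall>n\<ge>k + int J. Y (u i) n (v i) = 0"
    using assms
  proof (induction I rule: finite_induct)
    case empty
    then show ?case by simp
  next
    case (insert x I)
    then obtain J :: nat where J: "\<forall>i\<in>I. \<forall>n\<ge>k + int J. Y (u i) n (v i) = 0"
      by blast
    obtain N where N: "\<forall>n\<ge>N. Y (u x) n (v x) = 0"
      using truncation by blast
    have "\<forall>i\<in>insert x I. \<forall>n\<ge>k + int (max J (nat (N - k))). Y (u i) n (v i) = 0"
      using J N by auto
    then show ?case by blast
  qed
  then show thesis using that by blast
qed

text \<open>Borcherds' identity, with a common cut-off \<open>J\<close> beyond which all terms
  vanish. The last coefficient equals \<open>m gchoose j\<close>. Large \<open>N\<close> makes the
  right side vanish (locality); large \<open>m\<close> kills the second sum (associativity).\<close>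

lemma borcherds:
  fixes m n N :: int and J :: nat
  assumes vw: "\<And>j. j \<ge> n + int J \<Longrightarrow> Y v j w = 0"
    and uw: "\<And>j. j \<ge> m + int J \<Longrightarrow> Y u j w = 0"
    and uv: "\<And>j. j \<ge> N + int J \<Longrightarrow> Y u j v = 0"
  shows "(\<Sum>j<J. scale ((- 1) ^ j * (of_int N gchoose j)) (Y u (m + N - int j) (Y v (n + int j) w)))
       - (\<Sum>j<J. scale ((- 1) powi (- N) * ((- 1) ^ j * (of_int N gchoose j)))
             (Y v (n + N - int j) (Y u (m + int j) w)))
       = (\<Sum>j<J. scale ((- 1) ^ j * (of_int (int j - m - 1) gchoose j))
             (Y (Y u (N + int j) v) (m + n - int j) w))"
proof -
  \<comment> \<open>These are the exponents of \<open>z0\<close>, \<open>z1\<close>,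
    \<open>z2\<close> at which the Jacobi identity is read off; \<open>- a - 1 = N\<close> is the
    power of \<open>z1 - z2\<close>.\<close>
  define a b c where "a = - N - 1" and "b = - m - 1" and "c = - n - 1"
  note abc = a_def b_def c_def
  let ?f1 = "\<lambda>(p, q). scale (delta_coeff 1 (b + p + 1) (c + q + 1) a) (Y u p (Y v q w))"
  let ?f2 = "\<lambda>(p, q). scale (delta_coeff (- 1) (c + q + 1) (b + p + 1) a) (Y v q (Y u p w))"
  let ?f3 = "\<lambda>(p, q). scale (delta_coeff 1 b (a + p + 1) (c + q + 1)) (Y (Y u p v) q w)"
  have 1: "Sum_any ?f1 = sum ?f1 ((\<lambda>j. (m + N - int j, n + int j)) ` {..<J})"
  proof (rule Sum_any.expand_superset; clarsimp)
    fix p q assume nz: "delta_coeff 1 (b + p + 1) (c + q + 1) a \<noteq> 0" "Y u p (Y v q w) \<noteq> 0"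
    then have "q < n + int J" using vw[of q] by (cases "q < n + int J") auto
    moreover from nz have "q \<ge> n \<and> p = m + N + n - q"
      by (auto simp: delta_coeff_def binomial_coeff_def abc split: if_splits)
    ultimately show "(p, q) \<in> (\<lambda>j. (m + N - int j, n + int j)) ` {..<J}"
      by (intro image_eqI[of _ _ "nat (q - n)"]) auto
  qed
  have 2: "Sum_any ?f2 = sum ?f2 ((\<lambda>j. (m + int j, n + N - int j)) ` {..<J})"
  proof (rule Sum_any.expand_superset; clarsimp)
    fix p q assume nz: "delta_coeff (- 1) (c + q + 1) (b + p + 1) a \<noteq> 0" "Y v q (Y u p w) \<noteq> 0"
    then have "p < m + int J" using uw[of p] by (cases "p < m + int J") auto
    moreover from nz have "p \<ge> m \<and> q = m + N + n - p"
      by (auto simp: delta_coeff_def binomial_coeff_def abc split: if_splits)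
    ultimately show "(p, q) \<in> (\<lambda>j. (m + int j, n + N - int j)) ` {..<J}"
      by (intro image_eqI[of _ _ "nat (p - m)"]) auto
  qed
  have 3: "Sum_any ?f3 = sum ?f3 ((\<lambda>j. (N + int j, m + n - int j)) ` {..<J})"
  proof (rule Sum_any.expand_superset; clarsimp)
    fix p q assume nz: "delta_coeff 1 b (a + p + 1) (c + q + 1) \<noteq> 0" "Y (Y u p v) q w \<noteq> 0"
    then have "p < N + int J" using uv[of p] by (cases "p < N + int J") auto
    moreover from nz have "p \<ge> N \<and> q = m + N + n - p"
      by (auto simp: delta_coeff_def binomial_coeff_def abc split: if_splits)
    ultimately show "(p, q) \<in> (\<lambda>j. (N + int j, m + n - int j)) ` {..<J}"
      by (intro image_eqI[of _ _ "nat (p - N)"]) auto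
  qed
  have d1: "delta_coeff \<epsilon> (N - int j) (int j) a = \<epsilon> powi (- N) * ((- 1) ^ j * (of_int N gchoose j))" for \<epsilon> j
    by (simp add: delta_coeff_def binomial_coeff_def a_def)
  have d2: "delta_coeff 1 b (int j) (m - int j) = (- 1) ^ j * (of_int (int j - m - 1) gchoose j)" for j
    by (simp add: delta_coeff_def binomial_coeff_def b_def)
  have i1: "b + (m + N - int j) + 1 = N - int j" "c + (n + int j) + 1 = int j"
    "b + (m + int j) + 1 = int j" "c + (n + N - int j) + 1 = N - int j"
    "a + (N + int j) + 1 = int j" "c + (m + n - int j) + 1 = m - int j" for j
    by (simp_all add: abc)
  have "Sum_any ?f1 = (\<Sum>j<J. scale ((- 1) ^ j * (of_int N gchoose j)) (Y u (m + N - int j) (Y v (n + int j) w)))"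
    unfolding 1 by (subst sum.reindex) (simp_all add: inj_on_def i1 d1)
  moreover have "Sum_any ?f2 = (\<Sum>j<J. scale ((- 1) powi (- N) * ((- 1) ^ j * (of_int N gchoose j)))
             (Y v (n + N - int j) (Y u (m + int j) w)))"
    unfolding 2 by (subst sum.reindex) (simp_all add: inj_on_def i1 d1)
  moreover have "Sum_any ?f3 = (\<Sum>j<J. scale ((- 1) ^ j * (of_int (int j - m - 1) gchoose j))
             (Y (Y u (N + int j) v) (m + n - int j) w))"
    unfolding 3 by (subst sum.reindex) (simp_all add: inj_on_def i1 d2)
  ultimately show ?thesis
    using jacobi[of b c a u v w] by simp
qed

text \<open>Sums suffice to describe the linear span of the modes, because a scalar can be absorbed
  into the state \<open>u\<close>.\<close>

inductive mode_comb :: "('v \<Rightarrow> 'v) \<Rightarrow> bool" where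
  zero: "mode_comb (\<lambda>_. 0)"
| step: "mode_comb e \<Longrightarrow> mode_comb (\<lambda>w. Y u n w + e w)"

lemma mode_comb_mode: "mode_comb (Y u n)"
  using mode_comb.step[OF mode_comb.zero, of u n] by simp

lemma mode_comb_add: "mode_comb e \<Longrightarrow> mode_comb f \<Longrightarrow> mode_comb (\<lambda>w. e w + f w)"
  by (induction rule: mode_comb.induct) (auto simp: add.assoc intro: mode_comb.step)

lemma mode_comb_scale: "mode_comb e \<Longrightarrow> mode_comb (\<lambda>w. scale c (e w))"
proof (induction rule: mode_comb.induct)
  case zero
  then show ?case by (simp add: mode_comb.zero)
next
  case (step e u n)
  then show ?case
    using mode_comb.step[of _ "scale c u" n] by (simp add: scale_right_distrib state_scale)
qed

lemma mode_comb_sum: "(\<And>i. i \<in> I \<Longrightarrow> mode_comb (e i)) \<Longrightarrow> mode_comb (\<lambda>w. \<Sum>i\<in>I. e i w)"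
  by (induction I rule: infinite_finite_induct) (auto intro: mode_comb.zero mode_comb_add)

lemma mode_comb_linear: "mode_comb e \<Longrightarrow> Vector_Spaces.linear scale scale e"
  by (induction rule: mode_comb.induct)
    (auto simp: Vector_Spaces.linear_iff vector_space_axioms mode_add mode_scale scale_right_distrib)

lemmas mode_comb_hom = mode_comb_linear[unfolded linear_iff_module_hom]

text \<open>Products of modes are sums of modes only after restriction to finitely many vectors,
  since the associativity relations depend on where the modes vanish.\<close>

lemma mode_comp_mode:
  assumes F: "finite F"
  shows "\<exists>e. mode_comb e \<and> (\<forall>w\<in>F. Y u s (Y v t w) = e w)"
proof -
  obtain K :: nat where K: "\<And>w n. w \<in> F \<Longrightarrow> n \<ge> 0 + int K \<Longrightarrow> Y u n w = 0"
    using truncation_uniform[OF F, where u = "\<lambda>_. u" and v = "\<lambda>w. w"] by blast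
  obtain T :: nat where T: "\<And>w n. w \<in> F \<Longrightarrow> n \<ge> 0 + int T \<Longrightarrow> Y v n w = 0"
    using truncation_uniform[OF F, where u = "\<lambda>_. v" and v = "\<lambda>w. w"] by blast
  show ?thesis
  \<comment> \<open>Descending induction on \<open>t\<close>, starting at \<open>T\<close>, where
    \<open>Y v t\<close> kills \<open>F\<close>.\<close>
  proof (induction "nat (int T - t)" arbitrary: s t rule: less_induct)
    case less
    show ?case
    proof (cases "t \<ge> int T")
      case True
      then have "\<forall>w\<in>F. Y u s (Y v t w) = 0" using T by simp
      then show ?thesis using mode_comb.zero by blast
    next
      case False
      \<comment> \<open>In \<open>borcherds\<close> with \<open>m = K\<close> the second sum
        vanishes on \<open>F\<close>, and this \<open>N\<close> makes the term \<open>j = 0\<close>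
        equal to \<open>Y u s (Y v t w)\<close>. The terms with \<open>j > 0\<close> have a larger
        inner index and fall to the induction hypothesis.\<close>
      define N where "N = s - int K"
      obtain R where R: "\<forall>n\<ge>R. Y u n v = 0"
        using truncation by blast
      define J' where "J' = nat (int T - t) + nat (R - N)"
      define J where "J = Suc J'"
      have J: "t + int J \<ge> int T" "N + int J \<ge> R"
        by (auto simp: J_def J'_def)
      define c where "c j = (- 1) ^ j * (of_int N gchoose j :: complex)" for j :: nat
      define c' where "c' j = (- 1) ^ j * (of_int (int j - int K - 1) gchoose j :: complex)" for j :: nat
      have c0: "c 0 = 1" by (simp add: c_def)
      have "\<forall>j. \<exists>e. mode_comb e \<and> (\<forall>w\<in>F. Y u (s - int (Suc j)) (Y v (t + int (Suc j)) w) = e w)"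
        using False by (intro allI less) auto
      then obtain E where E: "\<And>j. mode_comb (E j)"
        "\<And>j w. w \<in> F \<Longrightarrow> Y u (s - int (Suc j)) (Y v (t + int (Suc j)) w) = E j w"
        by metis
      have eq: "Y u s (Y v t w) = (\<Sum>j<J. scale (c' j) (Y (Y u (N + int j) v) (int K + t - int j) w))
          + (\<Sum>j<J'. scale (- c (Suc j)) (E j w))" if w: "w \<in> F" for w
      proof -
        have "(\<Sum>j<J. scale (c j) (Y u (int K + N - int j) (Y v (t + int j) w)))
          - (\<Sum>j<J. scale ((- 1) powi (- N) * c j) (Y v (t + N - int j) (Y u (int K + int j) w)))
          = (\<Sum>j<J. scale (c' j) (Y (Y u (N + int j) v) (int K + t - int j) w))"
          unfolding c_def c'_def
          by (rule borcherds) (use K[OF w] T[OF w] R J in simp_all)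
        moreover have "(\<Sum>j<J. scale ((- 1) powi (- N) * c j) (Y v (t + N - int j) (Y u (int K + int j) w))) = 0"
          using K w by (intro sum.neutral) auto
        moreover have "(\<Sum>j<J. scale (c j) (Y u (int K + N - int j) (Y v (t + int j) w)))
            = Y u s (Y v t w) + (\<Sum>j<J'. scale (c (Suc j)) (E j w))"
          unfolding J_def sum.lessThan_Suc_shift using E(2)[OF w]
          by (simp add: c0 N_def algebra_simps)
        ultimately show ?thesis
          by (simp add: sum_negf algebra_simps)
      qed
      show ?thesis
      proof (intro exI conjI ballI)
        show "mode_comb (\<lambda>w. (\<Sum>j<J. scale (c' j) (Y (Y u (N + int j) v) (int K + t - int j) w))
          + (\<Sum>j<J'. scale (- c (Suc j)) (E j w)))"
          by (intro mode_comb_add mode_comb_sum mode_comb_scale mode_comb_mode E)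
      qed (rule eq)
    qed
  qed
qed

lemma mode_comb_comp:
  assumes e: "mode_comb e" and f: "mode_comb f" and F: "finite F"
  shows "\<exists>g. mode_comb g \<and> (\<forall>w\<in>F. e (f w) = g w)"
proof -
  have mode: "\<exists>g. mode_comb g \<and> (\<forall>w\<in>F. Y u n (f w) = g w)" for u n
    using f
  proof (induction rule: mode_comb.induct)
    case zero
    then show ?case by (auto intro: mode_comb.zero exI[of _ "\<lambda>_. 0"])
  next
    case (step f v t)
    then obtain g where g: "mode_comb g" "\<forall>w\<in>F. Y u n (f w) = g w" by blast
    obtain h where h: "mode_comb h" "\<forall>w\<in>F. Y u n (Y v t w) = h w"
      using mode_comp_mode[OF F] by blast
    show ?case
      using g h by (intro exI[of _ "\<lambda>w. h w + g w"]) (auto simp: mode_add intro: mode_comb_add)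
  qed
  show ?thesis
    using e
  proof (induction rule: mode_comb.induct)
    case zero
    then show ?case by (auto intro: mode_comb.zero exI[of _ "\<lambda>_. 0"])
  next
    case (step e u n)
    then obtain g where g: "mode_comb g" "\<forall>w\<in>F. e (f w) = g w" by blast
    obtain h where h: "mode_comb h" "\<forall>w\<in>F. Y u n (f w) = h w"
      using mode by blast
    show ?case
      using g h by (intro exI[of _ "\<lambda>w. h w + g w"]) (auto intro: mode_comb_add)
  qed
qed

end

section \<open>Schur's lemma in countable dimension\<close>

locale simple_countable_vertex_algebra = vertex_algebra scale vac Y
  for scale :: "complex \<Rightarrow> 'v::ab_group_add \<Rightarrow> 'v" and vac Y +
  assumes simple: "simple_vertex_algebra UNIV"
    and countable_dimension: "countable_dimension"
begin

lemma stable_subspace: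
  assumes "subspace W" "\<And>u n w. w \<in> W \<Longrightarrow> Y u n w \<in> W" "w \<in> W" "w \<noteq> 0"
  shows "W = UNIV"
  using simple assms unfolding simple_vertex_algebra_def by blast

lemma vac_nonzero: "vac \<noteq> 0"
proof
  assume "vac = 0"
  then have "w = 0" for w :: 'v using mode_vac[of w] by simp
  then show False using simple by (auto simp: simple_vertex_algebra_def)
qed

text \<open>Some shift \<open>D = d - c\<close> is not bijective by
  \<open>exists_not_bij_shift\<close>. Its kernel and range are stable under all modes, so a nonzero
  \<open>D\<close> would be bijective by simplicity.\<close>

lemma schur:
  assumes d: "Vector_Spaces.linear scale scale d" and comm: "\<And>u n x. d (Y u n x) = Y u n (d x)"
  obtains c where "\<And>x. d x = scale c x"
proof -
  interpret complex_endomorphism scale d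
    using d by (simp add: complex_endomorphism_def)
  obtain B where "countable B" "span B = UNIV"
    using countable_dimension unfolding countable_dimension_def by blast
  then obtain c where c: "\<not> bij (\<lambda>x. d x - scale c x)"
    using exists_not_bij_shift[OF _ _ vac_nonzero] by blast
  define D where "D x = d x - scale c x" for x
  have D: "D (x + y) = D x + D y" "D (scale r x) = scale r (D x)" "D (Y u n x) = Y u n (D x)" for x y r u n
    by (auto simp: D_def add scale comm mode_diff mode_scale scale_right_distrib scale_right_diff_distrib
        scale_left_commute)
  have D0: "D 0 = 0" using D(2)[of 0 0] by simp
  have Ddiff: "D (x - y) = D x - D y" for x y
    using D(1)[of x "scale (- 1) y"] unfolding D(2) by simp
  have "D x = 0" for x
  proof (rule ccontr)
    assume x: "D x \<noteq> 0"
    have "range D = UNIV"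
    proof (rule stable_subspace)
      show "subspace (range D)"
        using D D0 by (auto simp: subspace_def) (metis rangeI)+
      show "Y u n w \<in> range D" if "w \<in> range D" for u n w
        using that D(3) by (metis imageE rangeI)
    qed (use x in auto)
    moreover have "y = 0" if "D y = 0" for y
    proof (rule ccontr)
      assume "y \<noteq> 0"
      have "{y. D y = 0} = UNIV"
        by (rule stable_subspace[of _ y]) (use D D0 that \<open>y \<noteq> 0\<close> in \<open>auto simp: subspace_def\<close>)
      then show False using x by blast
    qed
    then have "inj D"
      by (intro injI) (metis Ddiff eq_iff_diff_eq_0)
    ultimately have "bij D" by (simp add: bij_def)
    then show False using c unfolding D_def by simp
  qed
  then show thesis using that[of c] by (simp add: D_def)
qed

end

subsection \<open>Density\<close>

context vertex_algebra
begin

text \<open>Locality \<open>(z\<^sub>1 - z\<^sub>2)\<^sup>N [Y(x,z\<^sub>1), Y(u\<^sub>i,z\<^sub>2)] = 0\<close> moves \<open>Y(x,z\<^sub>1)\<close> past the relation; the factor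
  \<open>(z\<^sub>1 - z\<^sub>2)\<^sup>N\<close> cancels because \<open>Y(x,z\<^sub>1) v\<^sub>i\<close> has only finitely many negative powers of \<open>z\<^sub>1\<close>.\<close>

lemma mode_relation_mode:
  assumes S: "finite S" and rel: "\<And>n. (\<Sum>i\<in>S. Y (u i) n (v i)) = 0"
  shows "(\<Sum>i\<in>S. Y (u i) n (Y x m (v i))) = 0"
proof -
  obtain N0 :: nat where N0: "\<And>i n. i \<in> S \<Longrightarrow> n \<ge> 0 + int N0 \<Longrightarrow> Y x n (u i) = 0"
    using truncation_uniform[OF S, where u = "\<lambda>_. x" and v = u] by blast
  obtain T :: nat where T: "\<And>i n. i \<in> S \<Longrightarrow> n \<ge> 0 + int T \<Longrightarrow> Y x n (v i) = 0"
    using truncation_uniform[OF S, where u = "\<lambda>_. x" and v = v] by blast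
  define N where "N = int N0"
  define D where "D n m = (\<Sum>i\<in>S. Y (u i) n (Y x m (v i)))" for n m
  have "D n m = 0"
  \<comment> \<open>Descending induction on \<open>m\<close>: \<open>Y x m\<close> kills every
    \<open>v i\<close> for \<open>m \<ge> T\<close>, and the terms with \<open>j > 0\<close> below
    involve only \<open>m + j\<close>.\<close>
  proof (induction "nat (int T - m)" arbitrary: n m rule: less_induct)
    case less
    show ?case
    proof (cases "m \<ge> int T")
      case True
      then show ?thesis using T by (simp add: D_def)
    next
      case False
      \<comment> \<open>This shift makes the term \<open>j = 0\<close> of the sum of the
        \<open>?R i\<close> a nonzero multiple of \<open>D n m\<close>.\<close>
      define n' where "n' = n - N"
      obtain T' :: nat where T': "\<And>i k. i \<in> S \<Longrightarrow> k \<ge> n' + int T' \<Longrightarrow> Y (u i) k (v i) = 0"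
        using truncation_uniform[OF S, where u = u and v = v] by blast
      define J' where "J' = nat (int T - m) + T'"
      define J where "J = Suc J'"
      have J: "m + int J \<ge> int T" "J \<ge> T'"
        by (auto simp: J_def J'_def)
      define c where "c j = ((- 1) ^ j * (of_int N gchoose j) :: complex)" for j :: nat
      let ?L = "\<lambda>i. \<Sum>j<J. scale (c j) (Y x (m + N - int j) (Y (u i) (n' + int j) (v i)))"
      let ?R = "\<lambda>i. \<Sum>j<J. scale ((- 1) powi (- N) * c j) (Y (u i) (n' + N - int j) (Y x (m + int j) (v i)))"
      \<comment> \<open>Locality: all products \<open>Y x (N + j) (u i)\<close> vanish, hence so
        does the right side of \<open>borcherds\<close>.\<close>
      have "?L i = ?R i" if i: "i \<in> S" for i
      proof -
        have "?L i - ?R i = (\<Sum>j<J. scale ((- 1) ^ j * (of_int (int j - m - 1) gchoose j))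
             (Y (Y x (N + int j) (u i)) (m + n' - int j) (v i)))"
          unfolding c_def
          by (rule borcherds) (use N0[OF i] T[OF i] T'[OF i] J in \<open>simp_all add: N_def\<close>)
        also have "\<dots> = 0"
          using N0[OF i] by (simp add: N_def)
        finally show ?thesis by simp
      qed
      then have "(\<Sum>i\<in>S. ?R i) = (\<Sum>i\<in>S. ?L i)" by simp
      also have "\<dots> = (\<Sum>j<J. scale (c j) (Y x (m + N - int j) (\<Sum>i\<in>S. Y (u i) (n' + int j) (v i))))"
        by (subst sum.swap) (simp add: mode_sum scale_sum_right)
      also have "\<dots> = 0" by (simp add: rel)
      finally have "(\<Sum>i\<in>S. ?R i) = 0" .
      moreover have "(\<Sum>i\<in>S. ?R i) = (\<Sum>j<J. scale ((- 1) powi (- N) * c j) (D (n' + N - int j) (m + int j)))"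
        unfolding D_def by (subst sum.swap) (simp add: scale_sum_right)
      moreover have "D (n' + N - int (Suc j)) (m + int (Suc j)) = 0" for j
        using False by (intro less) auto
      ultimately have "scale ((- 1) powi (- N) * c 0) (D (n' + N) m) = 0"
        unfolding J_def sum.lessThan_Suc_shift by simp
      then show ?thesis
        by (simp add: c_def n'_def)
    qed
  qed
  then show ?thesis by (simp add: D_def)
qed

lemma mode_relation_mode_comb:
  assumes S: "finite S" and rel: "\<And>n. (\<Sum>i\<in>S. Y (u i) n (v i)) = 0" and e: "mode_comb e"
  shows "(\<Sum>i\<in>S. Y (u i) n (e (v i))) = 0"
  using e
proof (induction rule: mode_comb.induct)
  case (step e x m)
  then show ?case
    using mode_relation_mode[OF S, of u v, OF rel] by (simp add: mode_add sum.distrib)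
qed simp

end

section \<open>Jacobson density for the simple module\<close>

context simple_countable_vertex_algebra
begin

text \<open>The values at \<open>w\<close> of the combinations killing \<open>S\<close> form a
  subspace stable under all modes; it contains \<open>e0 w\<close>, so by simplicity it is
  everything.\<close>

lemma annihilator_orbit:
  assumes S: "finite S" and e0: "mode_comb e0" "\<And>s. s \<in> S \<Longrightarrow> e0 s = 0" "e0 w \<noteq> 0"
  obtains e where "mode_comb e" "\<And>s. s \<in> S \<Longrightarrow> e s = 0" "e w = x"
proof -
  define J where "J = {e. mode_comb e \<and> (\<forall>s\<in>S. e s = 0)}"
  have "(\<lambda>e. e w) ` J = UNIV"
  proof (rule stable_subspace)
    show "subspace ((\<lambda>e. e w) ` J)"
    proof (rule subspaceI)
      show "0 \<in> (\<lambda>e. e w) ` J"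
        by (rule image_eqI[of _ _ "\<lambda>_. 0"]) (auto simp: J_def mode_comb.zero)
      show "x + y \<in> (\<lambda>e. e w) ` J" if xy: "x \<in> (\<lambda>e. e w) ` J" "y \<in> (\<lambda>e. e w) ` J" for x y
      proof -
        obtain e f where "e \<in> J" "f \<in> J" "x = e w" "y = f w" using xy by blast
        then show ?thesis
          by (intro image_eqI[of _ _ "\<lambda>w. e w + f w"]) (auto simp: J_def mode_comb_add)
      qed
      show "scale c x \<in> (\<lambda>e. e w) ` J" if x: "x \<in> (\<lambda>e. e w) ` J" for x c
      proof -
        obtain e where "e \<in> J" "x = e w" using x by blast
        then show ?thesis
          by (intro image_eqI[of _ _ "\<lambda>w. scale c (e w)"]) (auto simp: J_def mode_comb_scale)
      qed
    qed
    show "Y u n x \<in> (\<lambda>e. e w) ` J" if x: "x \<in> (\<lambda>e. e w) ` J" for u n x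
    proof -
      obtain e where e: "e \<in> J" "x = e w" using x by blast
      \<comment> \<open>The finite set contains \<open>w\<close> to preserve the value there, and
        \<open>S\<close> so that \<open>f\<close> kills it again.\<close>
      then obtain f where "mode_comb f" "\<forall>s\<in>insert w S. Y u n (e s) = f s"
        using mode_comb_comp[OF mode_comb_mode, of e "insert w S" u n] S by (auto simp: J_def)
      then show ?thesis
        using e by (intro image_eqI[of _ _ f]) (auto simp: J_def)
    qed
    show "e0 w \<in> (\<lambda>e. e w) ` J" using e0 by (auto simp: J_def)
  qed (rule e0)
  then have "x \<in> (\<lambda>e. e w) ` J" by simp
  then show thesis using that by (auto simp: J_def)
qed

lemma cyclic:
  assumes "w \<noteq> 0"
  obtains e where "mode_comb e" "e w = x"
  using annihilator_orbit[of "{}" "Y vac (- 1)" w x] assms mode_comb_mode by (auto simp: mode_vac)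

text \<open>Jacobson's argument. If every combination killing \<open>S\<close> and \<open>s\<close>
  also killed \<open>v\<close>, then \<open>e s \<mapsto> e v\<close>, for \<open>e\<close> killing
  \<open>S\<close>, would be a well-defined map commuting with all modes, hence a scalar by
  \<open>schur\<close>.\<close>

lemma separating_mode_comb:
  assumes "finite S" "v \<notin> span S"
  shows "\<exists>e. mode_comb e \<and> (\<forall>s\<in>S. e s = 0) \<and> e v \<noteq> 0"
  using assms
proof (induction S arbitrary: v rule: finite_induct)
  case empty
  then show ?case
    by (intro exI[of _ "Y vac (- 1)"] conjI mode_comb_mode) (auto simp: mode_vac)
next
  case (insert s S)
  show ?case
  proof (cases "s \<in> span S")
    case True
    have "v \<notin> span S"
      using insert.prems span_mono[of S "insert s S"] by blast
    then obtain e where e: "mode_comb e" "\<forall>s\<in>S. e s = 0" "e v \<noteq> 0"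
      using insert.IH by blast
    then have "e s = 0"
      using module_hom.eq_0_on_span[OF mode_comb_hom[OF e(1)] _ True] by blast
    then show ?thesis using e by blast
  next
    case False
    then obtain e0 where e0: "mode_comb e0" "\<And>t. t \<in> S \<Longrightarrow> e0 t = 0" "e0 s \<noteq> 0"
      using insert.IH by blast
    show ?thesis
    proof (rule ccontr)
      assume "\<not> ?thesis"
      then have kill: "e v = 0" if "mode_comb e" "\<forall>t\<in>S. e t = 0" "e s = 0" for e
        using that by auto
      have "\<forall>x. \<exists>e. mode_comb e \<and> (\<forall>t\<in>S. e t = 0) \<and> e s = x"
        using annihilator_orbit[OF insert.hyps(1) e0] by metis
      then obtain E where E: "\<And>x. mode_comb (E x)" "\<And>x t. t \<in> S \<Longrightarrow> E x t = 0" "\<And>x. E x s = x"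
        by metis
      define d where "d x = E x v" for x
      \<comment> \<open>Two combinations killing \<open>S\<close> with the same value at
        \<open>s\<close> differ by one that kills \<open>v\<close>, so \<open>d\<close> does not
        depend on the choice of \<open>E\<close>.\<close>
      have d: "d (e s) = e v" if e: "mode_comb e" "\<And>t. t \<in> S \<Longrightarrow> e t = 0" for e
      proof -
        have "e v + scale (- 1) (E (e s) v) = 0"
          by (rule kill[of "\<lambda>w. e w + scale (- 1) (E (e s) w)"], intro mode_comb_add mode_comb_scale E e)
            (auto simp: E e)
        then show ?thesis by (simp add: d_def)
      qed
      have add: "d (x + y) = d x + d y" for x y
        using d[of "\<lambda>w. E x w + E y w"] by (simp add: E mode_comb_add) (simp add: d_def)
      have scale: "d (scale c x) = scale c (d x)" for c x
        using d[of "\<lambda>w. scale c (E x w)"] by (simp add: E mode_comb_scale) (simp add: d_def)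
      have "d (Y u n x) = Y u n (d x)" for u n x
      proof -
        obtain f where f: "mode_comb f" "\<forall>w\<in>insert s (insert v S). Y u n (E x w) = f w"
          using mode_comb_comp[OF mode_comb_mode E(1), of "insert s (insert v S)" u n] insert.hyps by auto
        then show ?thesis
          using d[of f] by (simp add: E) (simp add: d_def)
      qed
      moreover have "Vector_Spaces.linear scale scale d"
        by (simp add: Vector_Spaces.linear_iff vector_space_axioms add scale)
      ultimately obtain c where c: "\<And>x. d x = scale c x"
        using schur by blast
      \<comment> \<open>Every \<open>e\<close> killing \<open>S\<close> satisfies
        \<open>e v = c (e s)\<close>, so it also kills this vector, against the induction
        hypothesis.\<close>
      have "v - scale c s \<notin> span S"
        using insert.prems by (auto simp: span_insert)
      then obtain e where e: "mode_comb e" "\<And>t. t \<in> S \<Longrightarrow> e t = 0" "e (v - scale c s) \<noteq> 0"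
        using insert.IH by blast
      have "e (v - scale c s) = 0"
        using d[OF e(1,2)] c
        by (simp add: module_hom.diff[OF mode_comb_hom[OF e(1)]] module_hom.scale[OF mode_comb_hom[OF e(1)]])
      then show False using e by simp
    qed
  qed
qed

text \<open>Each \<open>b\<close> gets a combination that kills the other basis vectors and takes
  the prescribed value at \<open>b\<close>; these are added up.\<close>

lemma density_independent:
  assumes B: "finite B" "independent B"
  obtains e where "mode_comb e" "\<And>b. b \<in> B \<Longrightarrow> e b = f b"
proof -
  have "\<exists>e. mode_comb e \<and> (\<forall>s\<in>B - {b}. e s = 0) \<and> e b = f b" if b: "b \<in> B" for b
  proof -
    have "b \<notin> span (B - {b})" using B b by (auto simp: dependent_def)
    then obtain e0 where "mode_comb e0" "\<forall>s\<in>B - {b}. e0 s = 0" "e0 b \<noteq> 0"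
      using separating_mode_comb[of "B - {b}" b] B by auto
    then show ?thesis
      using annihilator_orbit[of "B - {b}" e0 b "f b"] B by (metis finite_Diff)
  qed
  then obtain E where E: "\<And>b. b \<in> B \<Longrightarrow> mode_comb (E b)" "\<And>b. b \<in> B \<Longrightarrow> E b b = f b"
    "\<And>b s. b \<in> B \<Longrightarrow> s \<in> B - {b} \<Longrightarrow> E b s = 0"
    by metis
  show thesis
  proof
    show "mode_comb (\<lambda>w. \<Sum>b\<in>B. E b w)"
      using E by (intro mode_comb_sum)
    show "(\<Sum>b\<in>B. E b s) = f s" if "s \<in> B" for s
      using E that B by (subst sum.remove[of B s]) (auto intro!: sum.neutral)
  qed
qed

lemma density:
  assumes F: "finite F" and T: "Vector_Spaces.linear scale scale T"
  obtains e where "mode_comb e" "\<And>x. x \<in> F \<Longrightarrow> e x = T x"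
proof -
  obtain B where B: "B \<subseteq> F" "independent B" "F \<subseteq> span B"
    using maximal_independent_subset by blast
  then obtain e where e: "mode_comb e" "\<And>b. b \<in> B \<Longrightarrow> e b = T b"
    using density_independent finite_subset[OF _ F] by metis
  have "Vector_Spaces.linear scale scale (\<lambda>x. e x - T x)"
    using mode_comb_linear[OF e(1)] T
    by (simp add: Vector_Spaces.linear_iff algebra_simps scale_right_diff_distrib)
  then have "e x - T x = 0" if "x \<in> F" for x
    using module_hom.eq_0_on_span[of scale scale "\<lambda>x. e x - T x" B x] e B that
    by (auto simp: linear_iff_module_hom)
  then show thesis using e that by simp
qed

text \<open>Equivalently, \<open>\<Sum>\<^sub>i u\<^sub>i \<otimes> v\<^sub>i \<mapsto> \<Sum>\<^sub>i Y(u\<^sub>i,z) v\<^sub>i\<close> is injective on \<open>V \<otimes> V\<close>.\<close>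

lemma tensor_injective:
  assumes S: "finite S" and rel: "\<And>n. (\<Sum>i\<in>S. Y (u i) n (v i)) = 0"
    and \<phi>: "Vector_Spaces.linear scale (*) \<phi>"
  shows "(\<Sum>i\<in>S. scale (\<phi> (v i)) (u i)) = 0"
proof -
  \<comment> \<open>Density yields a combination sending each \<open>v i\<close> to
    \<open>\<phi> (v i)\<close> times the vacuum; mode \<open>- 1\<close> then recovers
    \<open>u i\<close> by the creation axiom.\<close>
  have "Vector_Spaces.linear scale scale (\<lambda>x. scale (\<phi> x) vac)"
    using \<phi> by (simp add: Vector_Spaces.linear_iff scale_left_distrib)
  then obtain e where e: "mode_comb e" "\<And>x. x \<in> v ` S \<Longrightarrow> e x = scale (\<phi> x) vac"
    using density[of "v ` S"] S by blast
  have "(\<Sum>i\<in>S. scale (\<phi> (v i)) (u i)) = (\<Sum>i\<in>S. Y (u i) (- 1) (e (v i)))"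
    using e by (intro sum.cong) (auto simp: mode_scale creation)
  also have "\<dots> = 0"
    by (rule mode_relation_mode_comb[OF S rel e(1)])
  finally show ?thesis .
qed

end

subsection \<open>Galois correspondence\<close>

context vertex_algebra
begin

section \<open>Automorphism groups, fixed points and averaging\<close>

lemma subgroup_AutD:
  assumes K: "subgroup K Aut"
  shows "g \<in> K \<Longrightarrow> automorphism g"
    and "id \<in> K"
    and "g \<in> K \<Longrightarrow> h \<in> K \<Longrightarrow> g \<circ> h \<in> K"
    and "g \<in> K \<Longrightarrow> inv_into UNIV g \<in> K"
proof -
  interpret group Aut by (rule group_Aut)
  show aut: "automorphism g" if "g \<in> K" for g
    using subgroup.mem_carrier[OF K that] by (simp add: Aut_def)
  show "id \<in> K"
    using subgroup.one_closed[OF K] by (simp add: Aut_def)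
  show "g \<circ> h \<in> K" if "g \<in> K" "h \<in> K"
    using subgroup.m_closed[OF K that] by (simp add: Aut_def)
  show "inv_into UNIV g \<in> K" if g: "g \<in> K"
  proof -
    have "inv\<^bsub>Aut\<^esub> g = inv_into UNIV g"
    proof (rule inv_equality)
      show "inv_into UNIV g \<otimes>\<^bsub>Aut\<^esub> g = \<one>\<^bsub>Aut\<^esub>"
        using aut[OF g] by (simp add: Aut_def automorphism_def bij_is_inj)
    qed (use aut[OF g] automorphism_inv in \<open>auto simp: Aut_def\<close>)
    then show ?thesis using subgroup.m_inv_closed[OF K g] by simp
  qed
qed

lemma automorphism_hom: "automorphism g \<Longrightarrow> module_hom scale scale g"
  by (simp add: automorphism_def linear_iff_module_hom)

lemma automorphism_bij: "automorphism g \<Longrightarrow> bij g"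
  by (simp add: automorphism_def)

lemma automorphism_mode:
  assumes "automorphism g"
  shows "g (Y u n w) = Y (g u) n (g w)"
proof -
  have "g \<circ> Y u n \<circ> inv_into UNIV g = Y (g u) n" using assms by (simp add: automorphism_def)
  from fun_cong[OF this, of "g w"] show ?thesis
    using automorphism_bij[OF assms] by (simp add: bij_is_inj)
qed

lemma sum_orbit_fixed:
  assumes K: "subgroup K Aut"
  shows "(\<Sum>k\<in>K. k u) \<in> fixed_points K"
  unfolding fixed_points_def
proof safe
  fix h assume h: "h \<in> K"
  note bij = automorphism_bij[OF subgroup_AutD(1)[OF K h]]
  have "h (\<Sum>k\<in>K. k u) = (\<Sum>k\<in>K. (h \<circ> k) u)"
    using module_hom.sum[OF automorphism_hom[OF subgroup_AutD(1)[OF K h]]] by simp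
  also have "\<dots> = (\<Sum>k\<in>K. k u)"
    using h bij subgroup_AutD[OF K]
    by (intro sum.reindex_bij_witness[where i = "\<lambda>k. inv_into UNIV h \<circ> k" and j = "\<lambda>k. h \<circ> k"])
      (auto simp: fun_eq_iff bij_is_inj bij_is_surj surj_f_inv_f)
  finally show "h (\<Sum>k\<in>K. k u) = (\<Sum>k\<in>K. k u)" .
qed

text \<open>Averaging a combination of modes over \<open>K\<close> gives a combination of modes of \<open>V\<^sup>K\<close>.\<close>

lemma average_mode_comb:
  assumes K: "subgroup K Aut" and W: "subspace W"
    and stable: "\<And>u n w. u \<in> fixed_points K \<Longrightarrow> w \<in> W \<Longrightarrow> Y u n w \<in> W"
    and e: "mode_comb e" and x: "x \<in> W"
  shows "(\<Sum>k\<in>K. k (e (inv_into UNIV k x))) \<in> W"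
  using e
proof (induction rule: mode_comb.induct)
  case zero
  have "(\<Sum>k\<in>K. k 0) = (\<Sum>k\<in>K. (0 :: 'v))"
    using subgroup_AutD(1)[OF K] module_hom.zero[OF automorphism_hom] by (intro sum.cong) auto
  then show ?case using subspace_0[OF W] by simp
next
  case (step e u n)
  have "(\<Sum>k\<in>K. k (Y u n (inv_into UNIV k x) + e (inv_into UNIV k x)))
      = (\<Sum>k\<in>K. Y (k u) n x + k (e (inv_into UNIV k x)))"
  proof (rule sum.cong)
    fix k assume "k \<in> K"
    then have k: "automorphism k" by (rule subgroup_AutD(1)[OF K])
    then have "k (inv_into UNIV k x) = x"
      using automorphism_bij by (simp add: bij_is_surj surj_f_inv_f)
    then show "k (Y u n (inv_into UNIV k x) + e (inv_into UNIV k x))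
        = Y (k u) n x + k (e (inv_into UNIV k x))"
      by (simp add: module_hom.add[OF automorphism_hom[OF k]] automorphism_mode[OF k])
  qed simp
  also have "\<dots> = Y (\<Sum>k\<in>K. k u) n x + (\<Sum>k\<in>K. k (e (inv_into UNIV k x)))"
    by (simp add: sum.distrib state_sum)
  also have "\<dots> \<in> W"
    using step.IH stable[OF sum_orbit_fixed[OF K] x] W by (intro subspace_add)
  finally show ?case .
qed

lemma fixed_points_subalgebra:
  assumes K: "subgroup K Aut"
  shows "vertex_subalgebra (fixed_points K)"
proof -
  have aut: "automorphism k" if "k \<in> K" for k
    using subgroup_AutD(1)[OF K that] .
  note hom = automorphism_hom[OF aut]
  have "subspace (fixed_points K)"
    by (auto simp: subspace_def fixed_points_def module_hom.zero[OF hom] module_hom.add[OF hom]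
        module_hom.scale[OF hom])
  moreover have "vac \<in> fixed_points K"
    using aut by (auto simp: fixed_points_def automorphism_def)
  moreover have "Y u n v \<in> fixed_points K" if "u \<in> fixed_points K" "v \<in> fixed_points K" for u n v
    using that by (simp add: fixed_points_def) (metis aut automorphism_mode)
  ultimately show ?thesis
    by (simp add: vertex_subalgebra_def)
qed

lemma subgroup_stabilizer:
  assumes G: "subgroup G Aut"
  shows "subgroup {g \<in> G. \<forall>u\<in>U. g u = u} Aut" (is "subgroup ?S _")
proof (rule group.subgroupI[OF group_Aut])
  show "?S \<subseteq> carrier Aut"
    using subgroup.subset[OF G] by auto
  show "?S \<noteq> {}"
    using subgroup_AutD(2)[OF G] by auto
  fix a assume a: "a \<in> ?S"
  interpret group Aut by (rule group_Aut)
  have inv: "inv\<^bsub>Aut\<^esub> a \<in> G"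
    using a subgroup.m_inv_closed[OF G] by auto
  have "inv\<^bsub>Aut\<^esub> a \<circ> a = id"
    using l_inv[of a] a subgroup.subset[OF G] by (auto simp: Aut_def)
  then have "(inv\<^bsub>Aut\<^esub> a) u = u" if "u \<in> U" for u
    using a that by (metis (mono_tags, lifting) comp_apply id_apply mem_Collect_eq)
  with inv show "inv\<^bsub>Aut\<^esub> a \<in> ?S" by simp
next
  fix a b assume "a \<in> ?S" "b \<in> ?S"
  then show "a \<otimes>\<^bsub>Aut\<^esub> b \<in> ?S"
    using subgroup_AutD(3)[OF G] by (auto simp: Aut_def)
qed

end

section \<open>Linear relations between automorphisms and the correspondence\<close>

context simple_countable_vertex_algebra
begin

text \<open>The relation is applied to \<open>Y x n v\<close>, where each \<open>g\<close> acts on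
  both factors; \<open>tensor_injective\<close> then contracts the factor \<open>g v\<close> with
  \<open>\<phi>\<close>.\<close>

lemma relation_times_coefficient:
  assumes G: "finite G" "\<And>g. g \<in> G \<Longrightarrow> automorphism g"
    and U: "\<And>u v n. u \<in> U \<Longrightarrow> v \<in> U \<Longrightarrow> Y u n v \<in> U"
    and rel: "\<And>x. x \<in> U \<Longrightarrow> (\<Sum>g\<in>G. scale (a g) (g x)) = 0"
    and v: "v \<in> U" and \<phi>: "Vector_Spaces.linear scale (*) \<phi>" and x: "x \<in> U"
  shows "(\<Sum>g\<in>G. scale (a g * \<phi> (g v)) (g x)) = 0"
proof -
  have "(\<Sum>g\<in>G. Y (scale (a g) (g x)) n (g v)) = 0" for n
  proof -
    have "(\<Sum>g\<in>G. Y (scale (a g) (g x)) n (g v)) = (\<Sum>g\<in>G. scale (a g) (g (Y x n v)))"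
      using G(2) by (intro sum.cong) (auto simp: automorphism_mode state_scale)
    then show ?thesis using rel U x v by simp
  qed
  from tensor_injective[OF G(1) this \<phi>] show ?thesis
    by (simp add: mult.commute)
qed

text \<open>A product of affine functions of matrix coefficients \<open>\<phi> (g u)\<close>, \<open>u \<in> U\<close>, isolates the automorphisms that
  agree with \<open>g0\<close> on \<open>U\<close>; then evaluate at the vacuum.\<close>

lemma relation_class_sum:
  assumes G: "finite G" "\<And>g. g \<in> G \<Longrightarrow> automorphism g"
    and U: "vertex_subalgebra U"
    and rel: "\<And>x. x \<in> U \<Longrightarrow> (\<Sum>g\<in>G. scale (a g) (g x)) = 0"
  shows "(\<Sum>g\<in>{g\<in>G. \<forall>u\<in>U. g u = g0 u}. a g) = 0"
proof -
  define C where "C = {g\<in>G. \<forall>u\<in>U. g u = g0 u}"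
  have Y_U: "Y u n v \<in> U" if "u \<in> U" "v \<in> U" for u v n
    using U that by (simp add: vertex_subalgebra_def)
  have sep: "\<exists>p. (\<forall>g\<in>C. p g = 1) \<and> (\<forall>g\<in>S. p g = 0)
      \<and> (\<forall>x\<in>U. (\<Sum>g\<in>G. scale (a g * p g) (g x)) = 0)"
    if "finite S" "S \<subseteq> G - C" for S
    using that
  proof (induction S rule: finite_induct)
    case empty
    then show ?case using rel by (intro exI[of _ "\<lambda>_. 1"]) simp
  next
    case (insert h S)
    then obtain p where p: "\<forall>g\<in>C. p g = 1" "\<forall>g\<in>S. p g = 0"
      "\<And>x. x \<in> U \<Longrightarrow> (\<Sum>g\<in>G. scale (a g * p g) (g x)) = 0"
      by blast
    obtain v where v: "v \<in> U" "h v \<noteq> g0 v"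
      using insert.prems by (auto simp: C_def)
    obtain \<phi> where \<phi>: "Vector_Spaces.linear scale (*) \<phi>" "\<phi> (g0 v - h v) = 1"
      using separating_functional[of "{0}" "g0 v - h v"] v by (auto simp: subspace_single_0)
    have \<phi>1: "\<phi> (g0 v) - \<phi> (h v) = 1"
      using \<phi> module_hom.diff[of scale "(*)" \<phi>] by (simp add: linear_iff_module_hom)
    \<comment> \<open>The new factor vanishes at \<open>h\<close> and equals 1 on \<open>C\<close>,
      where \<open>g v = g0 v\<close>.\<close>
    define q where "q g = p g * (\<phi> (g v) - \<phi> (h v))" for g
    have "(\<Sum>g\<in>G. scale (a g * q g) (g x)) = 0" if x: "x \<in> U" for x
    proof -
      have "(\<Sum>g\<in>G. scale (a g * q g) (g x))
          = (\<Sum>g\<in>G. scale (a g * p g * \<phi> (g v)) (g x)) - scale (\<phi> (h v)) (\<Sum>g\<in>G. scale (a g * p g) (g x))"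
        by (simp add: q_def scale_sum_right sum_subtractf[symmetric] algebra_simps)
      also have "\<dots> = 0"
        using relation_times_coefficient[OF G Y_U p(3) v(1) \<phi>(1) x] p(3)[OF x] by simp
      finally show ?thesis .
    qed
    moreover have "\<forall>g\<in>C. q g = 1"
      using p \<phi>1 v(1) by (auto simp: q_def C_def)
    moreover have "\<forall>g\<in>insert h S. q g = 0"
      using p by (auto simp: q_def)
    ultimately show ?case by blast
  qed
  obtain p where p: "\<forall>g\<in>C. p g = 1" "\<forall>g\<in>G - C. p g = 0"
    "\<forall>x\<in>U. (\<Sum>g\<in>G. scale (a g * p g) (g x)) = 0"
    using sep[of "G - C"] G by auto
  have "vac \<in> U" using U by (simp add: vertex_subalgebra_def)
  then have "0 = (\<Sum>g\<in>G. scale (a g * p g) (g vac))" using p by simp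
  also have "\<dots> = (\<Sum>g\<in>G. scale (a g * p g) vac)"
    using G(2) by (intro sum.cong) (auto simp: automorphism_def)
  also have "\<dots> = scale (\<Sum>g\<in>G. a g * p g) vac"
    by (simp add: scale_sum_left)
  also have "(\<Sum>g\<in>G. a g * p g) = (\<Sum>g\<in>C. a g)"
    using p G(1) by (intro sum.mono_neutral_cong_right) (auto simp: C_def)
  finally show ?thesis using vac_nonzero by (simp add: C_def)
qed

text \<open>Since \<open>k\<close> fixes all orbit sums of \<open>H\<close>, the sum over
  \<open>H\<close> minus the sum over the coset \<open>k H\<close> is zero on \<open>V\<close>. If
  \<open>k\<close> were outside \<open>H\<close>, the two sets would be disjoint and the coefficient
  1 at \<open>id\<close> would contradict \<open>relation_class_sum\<close> for
  \<open>U = UNIV\<close>.\<close>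

lemma mem_subgroup_if_fixes:
  assumes H: "subgroup H Aut" "finite H" and k: "automorphism k"
    and fix_H: "\<And>v. v \<in> fixed_points H \<Longrightarrow> k v = v"
  shows "k \<in> H"
proof (rule ccontr)
  assume "k \<notin> H"
  define K where "K = (\<lambda>h. k \<circ> h) ` H"
  note HD = subgroup_AutD[OF H(1)]
  have disj: "H \<inter> K = {}"
  proof (rule ccontr)
    assume "H \<inter> K \<noteq> {}"
    then obtain h where h: "h \<in> H" "k \<circ> h \<in> H" by (auto simp: K_def)
    have "(k \<circ> h) \<circ> inv_into UNIV h = k"
      using automorphism_bij[OF HD(1)[OF h(1)]] by (auto simp: fun_eq_iff bij_is_surj surj_f_inv_f)
    then show False
      using HD(3)[OF h(2) HD(4)[OF h(1)]] \<open>k \<notin> H\<close> by simp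
  qed
  have inj: "inj_on (\<lambda>h. k \<circ> h) H"
    using injD[OF bij_is_inj[OF automorphism_bij[OF k]]] by (intro inj_onI ext) (metis comp_apply)
  define a where "a g = (if g \<in> H then 1 else - 1 :: complex)" for g
  have rel: "(\<Sum>g\<in>H \<union> K. scale (a g) (g x)) = 0" for x
  proof -
    have "(\<Sum>g\<in>H \<union> K. scale (a g) (g x)) = (\<Sum>g\<in>H. scale (a g) (g x)) + (\<Sum>g\<in>K. scale (a g) (g x))"
      using H disj by (intro sum.union_disjoint) (auto simp: K_def)
    also have "(\<Sum>g\<in>H. scale (a g) (g x)) = (\<Sum>h\<in>H. h x)"
      by (simp add: a_def)
    also have "(\<Sum>g\<in>K. scale (a g) (g x)) = (\<Sum>g\<in>K. - g x)"
      using disj by (intro sum.cong) (auto simp: a_def)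
    also have "\<dots> = - (\<Sum>h\<in>H. k (h x))"
      unfolding K_def sum.reindex[OF inj] by (simp add: sum_negf)
    also have "(\<Sum>h\<in>H. k (h x)) = k (\<Sum>h\<in>H. h x)"
      by (simp add: module_hom.sum[OF automorphism_hom[OF k]])
    also have "\<dots> = (\<Sum>h\<in>H. h x)"
      using fix_H[OF sum_orbit_fixed[OF H(1)]] .
    finally show ?thesis by simp
  qed
  have "(\<Sum>g\<in>{g \<in> H \<union> K. \<forall>u\<in>UNIV. g u = id u}. a g) = 0"
  proof (rule relation_class_sum[OF _ _ _ rel])
    show "finite (H \<union> K)" using H by (simp add: K_def)
    show "automorphism g" if "g \<in> H \<union> K" for g
      using that HD(1) automorphism_comp[OF k] by (auto simp: K_def)
    show "vertex_subalgebra UNIV" by (simp add: vertex_subalgebra_def)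
  qed
  moreover have "{g \<in> H \<union> K. \<forall>u\<in>UNIV. g u = id u} = {id}"
    using HD(2) by (auto simp: fun_eq_iff)
  ultimately show False using HD(2) by (simp add: a_def)
qed

text \<open>A combination of modes carries a nonzero \<open>w\<close> in \<open>W\<close> to any
  given fixed \<open>v\<close>. Its average over \<open>H\<close> still does so up to the factor
  \<open>card H\<close>, and uses only modes of fixed vectors, so it preserves
  \<open>W\<close>.\<close>

lemma simple_fixed_points:
  assumes H: "subgroup H Aut" "finite H"
  shows "simple_vertex_algebra (fixed_points H)"
  unfolding simple_vertex_algebra_def
proof (intro conjI allI impI)
  have "vac \<in> fixed_points H"
    using fixed_points_subalgebra[OF H(1)] by (simp add: vertex_subalgebra_def)
  then show "fixed_points H \<noteq> {0}" using vac_nonzero by auto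
  fix W assume W: "subspace W \<and> W \<subseteq> fixed_points H \<and> (\<forall>u\<in>fixed_points H. \<forall>n. \<forall>w\<in>W. Y u n w \<in> W)"
  show "W = {0} \<or> W = fixed_points H"
  proof (cases "W \<subseteq> {0}")
    case True
    then show ?thesis using W subspace_0 by blast
  next
    case False
    then obtain w where w: "w \<in> W" "w \<noteq> 0" by auto
    have "v \<in> W" if v: "v \<in> fixed_points H" for v
    proof -
      obtain e where e: "mode_comb e" "e w = v" using cyclic[OF w(2)] by blast
      have "k (e (inv_into UNIV k w)) = v" if k: "k \<in> H" for k
      proof -
        have "inv_into UNIV k w = w"
          using W w(1) subgroup_AutD(4)[OF H(1) k] by (auto simp: fixed_points_def)
        then show ?thesis using e v k by (simp add: fixed_points_def)
      qed
      then have "scale (of_nat (card H)) v = (\<Sum>k\<in>H. k (e (inv_into UNIV k w)))"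
        unfolding sum_constant_scale[symmetric] by (intro sum.cong refl) (rule sym)
      also have "\<dots> \<in> W"
        using W by (intro average_mode_comb[OF H(1) _ _ e(1) w(1)]) auto
      finally have "scale (inverse (of_nat (card H))) (scale (of_nat (card H)) v) \<in> W"
        using W subspace_scale by blast
      moreover have "card H \<noteq> 0" using H subgroup_AutD(2)[OF H(1)] by auto
      ultimately show ?thesis by simp
    qed
    then show ?thesis using W by blast
  qed
qed

text \<open>By density the \<open>G\<close>-equivariant maps \<open>x \<mapsto> \<Sum>\<^sub>g \<phi> (g x) g\<^sup>-\<^sup>1 v\<close> agree on finite sets with combinations
  of modes of \<open>V\<^sup>G\<close>, hence preserve \<open>U\<close>; so the coefficients \<open>\<psi> (g\<^sup>-\<^sup>1 v)\<close> annihilate \<open>U\<close> when \<open>\<psi>\<close> does.\<close>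

lemma fixed_points_stabilizer_subset:
  assumes G: "subgroup G Aut" "finite G" and U: "vertex_subalgebra U" "fixed_points G \<subseteq> U"
  shows "fixed_points {g \<in> G. \<forall>u\<in>U. g u = u} \<subseteq> U"
proof (rule subsetI, rule ccontr)
  fix v assume v: "v \<in> fixed_points {g \<in> G. \<forall>u\<in>U. g u = u}" and vU: "v \<notin> U"
  note GD = subgroup_AutD[OF G(1)]
  have subU: "subspace U" using U by (simp add: vertex_subalgebra_def)
  obtain \<psi> where \<psi>: "Vector_Spaces.linear scale (*) \<psi>" "\<And>u. u \<in> U \<Longrightarrow> \<psi> u = 0" "\<psi> v = 1"
    using separating_functional[OF subU vU] by blast
  note \<psi>_hom = \<psi>(1)[unfolded linear_iff_module_hom]
  have cardG: "card G \<noteq> 0" using G GD(2) by auto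
  have T_U: "(\<Sum>g\<in>G. scale (\<phi> (g u)) (inv_into UNIV g v)) \<in> U"
    if u: "u \<in> U" and \<phi>: "Vector_Spaces.linear scale (*) \<phi>" for u \<phi>
  proof -
    define T where "T x = (\<Sum>g\<in>G. scale (\<phi> (g x)) (inv_into UNIV g v))" for x
    note \<phi>_hom = \<phi>[unfolded linear_iff_module_hom]
    note g_hom = automorphism_hom[OF GD(1)]
    have "T (x + y) = T x + T y" for x y
      unfolding T_def sum.distrib[symmetric]
      by (intro sum.cong)
        (auto simp: module_hom.add[OF g_hom] module_hom.add[OF \<phi>_hom] scale_left_distrib)
    moreover have "T (scale c x) = scale c (T x)" for c x
      unfolding T_def scale_sum_right
      by (intro sum.cong) (auto simp: module_hom.scale[OF g_hom] module_hom.scale[OF \<phi>_hom])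
    ultimately have "Vector_Spaces.linear scale scale T"
      by (simp add: Vector_Spaces.linear_iff vector_space_axioms)
    \<comment> \<open>Averaging evaluates \<open>e\<close> at every translate of \<open>u\<close>,
      so agreement with \<open>T\<close> is needed on the whole finite orbit.\<close>
    then obtain e where e: "mode_comb e" "\<And>x. x \<in> (\<lambda>k. inv_into UNIV k u) ` G \<Longrightarrow> e x = T x"
      using density[of "(\<lambda>k. inv_into UNIV k u) ` G"] G(2) by blast
    \<comment> \<open>\<open>T\<close> commutes with \<open>G\<close>, so every conjugate
      contributes the same vector and the average over \<open>G\<close> recovers
      \<open>T u\<close>.\<close>
    have "k (e (inv_into UNIV k u)) = T u" if k: "k \<in> G" for k
    proof -
      note k_aut = GD(1)[OF k]
      note k_bij = automorphism_bij[OF k_aut]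
      have "k (e (inv_into UNIV k u)) = k (T (inv_into UNIV k u))"
        using e k by simp
      also have "\<dots> = (\<Sum>g\<in>G. scale (\<phi> (g (inv_into UNIV k u))) (k (inv_into UNIV g v)))"
        unfolding T_def
        by (simp add: module_hom.sum[OF automorphism_hom[OF k_aut]]
            module_hom.scale[OF automorphism_hom[OF k_aut]])
      also have "\<dots> = T u"
        unfolding T_def
      proof (rule sum.reindex_bij_witness[where i = "\<lambda>g. g \<circ> k" and j = "\<lambda>g. g \<circ> inv_into UNIV k"])
        fix g assume g: "g \<in> G"
        show "g \<circ> inv_into UNIV k \<circ> k = g" "g \<circ> k \<circ> inv_into UNIV k = g"
          using k_bij by (auto simp: fun_eq_iff bij_is_inj bij_is_surj surj_f_inv_f)
        show "g \<circ> inv_into UNIV k \<in> G" "g \<circ> k \<in> G"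
          using g k GD by auto
        have "inv_into UNIV (g \<circ> inv_into UNIV k) = k \<circ> inv_into UNIV g"
          using k_bij automorphism_bij[OF GD(1)[OF g]]
          by (subst o_inv_distrib) (auto simp: bij_imp_bij_inv inv_inv_eq)
        then show "scale (\<phi> ((g \<circ> inv_into UNIV k) u)) (inv_into UNIV (g \<circ> inv_into UNIV k) v)
            = scale (\<phi> (g (inv_into UNIV k u))) (k (inv_into UNIV g v))"
          by simp
      qed
      finally show ?thesis .
    qed
    then have "scale (of_nat (card G)) (T u) = (\<Sum>k\<in>G. k (e (inv_into UNIV k u)))"
      unfolding sum_constant_scale[symmetric] by (intro sum.cong refl) (rule sym)
    also have "\<dots> \<in> U"
      using U by (intro average_mode_comb[OF G(1) subU _ e(1) u]) (auto simp: vertex_subalgebra_def)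
    finally have "scale (inverse (of_nat (card G))) (scale (of_nat (card G)) (T u)) \<in> U"
      using subU subspace_scale by blast
    then show ?thesis using cardG by (simp add: T_def)
  qed
  define a where "a g = \<psi> (inv_into UNIV g v)" for g
  have rel: "(\<Sum>g\<in>G. scale (a g) (g u)) = 0" if u: "u \<in> U" for u
  proof (rule ccontr)
    assume nz: "(\<Sum>g\<in>G. scale (a g) (g u)) \<noteq> 0"
    then obtain \<phi> where \<phi>: "Vector_Spaces.linear scale (*) \<phi>" "\<phi> (\<Sum>g\<in>G. scale (a g) (g u)) = 1"
      using separating_functional[of "{0}"] by (auto simp: subspace_single_0)
    note \<phi>_hom = \<phi>(1)[unfolded linear_iff_module_hom]
    \<comment> \<open>The roles of \<open>\<phi>\<close> and \<open>\<psi>\<close> are exchanged: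
      the same number is \<open>\<psi>\<close> of a vector that lies in \<open>U\<close> by
      \<open>T_U\<close>.\<close>
    have "1 = (\<Sum>g\<in>G. a g * \<phi> (g u))"
      unfolding \<phi>(2)[symmetric] by (simp add: module_hom.sum[OF \<phi>_hom] module_hom.scale[OF \<phi>_hom])
    also have "\<dots> = \<psi> (\<Sum>g\<in>G. scale (\<phi> (g u)) (inv_into UNIV g v))"
      by (simp add: module_hom.sum[OF \<psi>_hom] module_hom.scale[OF \<psi>_hom] a_def mult.commute)
    also have "\<dots> = 0"
      using \<psi>(2)[OF T_U[OF u \<phi>(1)]] .
    finally show False by simp
  qed
  define H where "H = {g \<in> G. \<forall>u\<in>U. g u = u}"
  have H: "subgroup H Aut" unfolding H_def by (rule subgroup_stabilizer[OF G(1)])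
  have "finite H" using G by (simp add: H_def)
  \<comment> \<open>\<open>H\<close> is the class of the identity. Its elements fix
    \<open>v\<close>, so each coefficient is \<open>\<psi> v = 1\<close> and the sum is
    \<open>card H\<close>.\<close>
  have "(\<Sum>g\<in>H. a g) = 0"
    using relation_class_sum[OF G(2) GD(1) U(1) rel, of id] by (simp add: H_def)
  moreover have "a g = 1" if "g \<in> H" for g
    using v subgroup_AutD(4)[OF H that] \<psi>(3) by (auto simp: a_def fixed_points_def H_def)
  ultimately have "card H = 0" by simp
  then show False using \<open>finite H\<close> subgroup_AutD(2)[OF H] by auto
qed

text \<open>The pointwise stabilizer in \<open>G\<close> is a two-sided inverse of
  \<open>fixed_points\<close>. Hence every intermediate \<open>U\<close> is the fixed-point algebra
  of its stabilizer, and simplicity follows from \<open>simple_fixed_points\<close>.\<close>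

lemma galois_correspondence:
  assumes G: "subgroup G Aut" "finite G"
  shows "bij_betw fixed_points
           {H. subgroup H (Aut\<lparr>carrier := G\<rparr>)} {U. vertex_subalgebra U \<and> fixed_points G \<subseteq> U}"
    and "vertex_subalgebra U \<Longrightarrow> fixed_points G \<subseteq> U \<Longrightarrow> simple_vertex_algebra U"
proof -
  interpret group Aut by (rule group_Aut)
  have H: "subgroup H Aut" "H \<subseteq> G" "finite H" if "subgroup H (Aut\<lparr>carrier := G\<rparr>)" for H
    using incl_subgroup[OF G(1) that] subgroup.subset[OF that] finite_subset[OF _ G(2)] by auto
  define S where "S U = {g \<in> G. \<forall>u\<in>U. g u = u}" for U :: "'v set"
  have S: "subgroup (S U) Aut" for U
    unfolding S_def by (rule subgroup_stabilizer[OF G(1)])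
  have fixed_S: "fixed_points (S U) = U" if "vertex_subalgebra U" "fixed_points G \<subseteq> U" for U
    using fixed_points_stabilizer_subset[OF G that] by (auto simp: S_def fixed_points_def)
  have S_fixed: "S (fixed_points H) = H" if sub: "subgroup H (Aut\<lparr>carrier := G\<rparr>)" for H
  proof
    show "S (fixed_points H) \<subseteq> H"
      using mem_subgroup_if_fixes[OF H(1,3)[OF sub]] subgroup_AutD(1)[OF G(1)] by (auto simp: S_def)
    show "H \<subseteq> S (fixed_points H)"
      using H(2)[OF sub] by (auto simp: S_def fixed_points_def)
  qed
  show "bij_betw fixed_points
           {H. subgroup H (Aut\<lparr>carrier := G\<rparr>)} {U. vertex_subalgebra U \<and> fixed_points G \<subseteq> U}"
  proof (rule bij_betw_byWitness[where f' = S])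
    show "S ` {U. vertex_subalgebra U \<and> fixed_points G \<subseteq> U} \<subseteq> {H. subgroup H (Aut\<lparr>carrier := G\<rparr>)}"
      using subgroup_incl[OF S G(1)] by (auto simp: S_def)
    show "fixed_points ` {H. subgroup H (Aut\<lparr>carrier := G\<rparr>)} \<subseteq> {U. vertex_subalgebra U \<and> fixed_points G \<subseteq> U}"
      using H fixed_points_subalgebra by (fastforce simp: fixed_points_def)
  qed (use S_fixed fixed_S in auto)
  show "simple_vertex_algebra U" if "vertex_subalgebra U" "fixed_points G \<subseteq> U"
    using simple_fixed_points[OF S[of U]] fixed_S[OF that] G(2) by (simp add: S_def)
qed

end

theorem theorem5p6:
  fixes scale :: "complex \<Rightarrow> 'v::ab_group_add \<Rightarrow> 'v"
    and vac :: 'v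
    and Y :: "'v \<Rightarrow> int \<Rightarrow> 'v \<Rightarrow> 'v"
    and G :: "('v \<Rightarrow> 'v) set"
  assumes "vertex_algebra scale vac Y"
    and "vertex_algebra.simple_vertex_algebra scale Y UNIV"
    and "vertex_algebra.countable_dimension scale"
    and "subgroup G (vertex_algebra.Aut scale vac Y)"
    and "finite G"
  shows "bij_betw vertex_algebra.fixed_points
           {H. subgroup H ((vertex_algebra.Aut scale vac Y)\<lparr>carrier := G\<rparr>)}
           {U. vertex_algebra.vertex_subalgebra scale vac Y U \<and> vertex_algebra.fixed_points G \<subseteq> U}
         \<and> (\<forall>U. vertex_algebra.vertex_subalgebra scale vac Y U \<and> vertex_algebra.fixed_points G \<subseteq> U
               \<longrightarrow> vertex_algebra.simple_vertex_algebra scale Y U)"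
proof -
  interpret simple_countable_vertex_algebra scale vac Y
    using assms by (simp add: simple_countable_vertex_algebra_def simple_countable_vertex_algebra_axioms_def)
  show ?thesis
    using galois_correspondence[OF assms(4,5)] by blast
qed

end
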